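(* Let $x\in\mathbb{R}^n$ and assume that $f:\mathbb{R}^n\to\mathbb{R}$ is directed subdifferentiable at $x$. Then the object $\overrightarrow{\partial}f(x)$ defined recursively by (i) for $n=1$: $\overrightarrow{\partial}f(x):=(f'(x;-1),f'(x;1))$ (entries for $l=-1$ and $l=1$); (ii) for $n\ge2$: $\overrightarrow{\partial}f(x):=\left(\overrightarrow{\partial}f_l(0),\,f'(x;l)\right)_{l\in S_{n-1}}$, where $f_l:\mathbb{R}^{n-1}\to\mathbb{R}$, $f_l(y):=f'(x;\,l+\Pi_{n-1,l}^{\top}y)$, is a directed set in $\mathbb{R}^n$. Moreover, $$\|\overrightarrow{\partial}f(x)\|=\inf\{M\ge 0 \mid f\text{ is }M\text{-directed subdifferentiable at }x\},$$ and the infimum is attained.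
   Context: Notation. $S_{n-1}$ is the Euclidean unit sphere of $\mathbb{R}^n$. The (Dini) directional derivative is $f'(x;l):=\lim_{t\downarrow0}\frac{f(x+tl)-f(x)}{t}$. Rotations and projections. For every $n\ge2$ and $l\in S_{n-1}$ a rotation matrix $R_{n,l}$ of $\mathbb{R}^n$ is fixed once and for all with $R_{n,l}(l)=e^n$ and $R_{n,l}(\mathrm{span}\{l\}^\perp)=\mathrm{span}\{e^1,\dots,e^{n-1}\}$. Let $\pi_{n-1,n}\in\mathbb{R}^{(n-1)\times n}$, $\pi_{n-1,n}(x_1,\dots,x_n)=(x_1,\dots,x_{n-1})$, and $\Pi_{n-1,l}:=\pi_{n-1,n}R_{n,l}$. Its transpose $\Pi_{n-1,l}^{\top}=R_{n,l}^{-1}\pi_{n-1,n}^{\top}$ maps $\mathbb{R}^{n-1}$ onto $\mathrm{span}\{l\}^\perp$. Directed sets (recursive definition). A directed set in $\mathbb{R}$ is a pair $\overrightarrow{A}=(a_1(-1),a_1(1))=(a_1(l))_{l=\pm1}\in\mathbb{R}^2$, also written as the directed interval $\overrightarrow{[-a_1(-1),a_1(1)]}$, with norm $\|\overrightarrow{A}\|_1=\max_{l=\pm1}|a_1(l)|$. For $n\ge2$, a directed set in $\mathbb{R}^n$ is $\overrightarrow{A}=(\overrightarrow{A_{n-1}(l)},a_n(l))_{l\in S_{n-1}}$, where $a_n:S_{n-1}\to\mathbb{R}$ is continuous and $\overrightarrow{A_{n-1}}:S_{n-1}\to\mathcal{D}(\mathbb{R}^{n-1})$ is a map into the set $\mathcal{D}(\mathbb{R}^{n-1})$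 of directed sets in $\mathbb{R}^{n-1}$ that is uniformly bounded with respect to $\|\cdot\|_{n-1}$; its norm is $\|\overrightarrow{A}\|=\|\overrightarrow{A}\|_n=\max\{\sup_{l\in S_{n-1}}\|\overrightarrow{A_{n-1}(l)}\|_{n-1},\max_{l\in S_{n-1}}|a_n(l)|\}$. Directed subdifferentiable functions (recursive definition). Let $M\ge0$. A function $f:\mathbb{R}\to\mathbb{R}$ is $M$-directed subdifferentiable at $x\in\mathbb{R}$ iff both one-sided directional derivatives $f'(x;-1),f'(x;1)$ exist and $\max\{|f'(x;-1)|,|f'(x;1)|\}\le M$. A function $f:\mathbb{R}^n\to\mathbb{R}$, $n\ge2$, is $M$-directed subdifferentiable at $x\in\mathbb{R}^n$ iff $f'(x;l)$ exists for every $l$, is continuous as a function of $l$, satisfies $\max_{l\in S_{n-1}}|f'(x;l)|\le M$, and for every $l\in S_{n-1}$ the function $f_l(\cdot)=f'(x;\,l+\Pi_{n-1,l}^{\top}(\cdot)):\mathbb{R}^{n-1}\to\mathbb{R}$ is $M$-directed subdifferentiable at $0_{n-1}$. The function $f$ is directed subdifferentiable at $x$ iff it is $M$-directed subdifferentiable at $x$ for some $M\ge0$. *)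

theory Defs
  imports
    "HOL-Analysis.Analysis"
    "Jordan_Normal_Form.VS_Connect"
begin

unbundle no inner_syntax and no vec_syntax

text \<open>
  The dimension is a recursion parameter, so \<open>\<real>\<^sup>n\<close> is \<^term>\<open>carrier_vec n :: real vec set\<close>
  with 0-based coordinates: the paper's \<open>e\<^sup>i\<close> is \<^term>\<open>unit_vec n (i - 1)\<close>, and \<open>\<real>\<close> itself is
  identified with \<^term>\<open>carrier_vec 1 :: real vec set\<close>. A function \<open>\<real>\<^sup>n \<Rightarrow> \<real>\<close> is a total function
  on \<^typ>\<open>real vec\<close> of which only the values on \<^term>\<open>carrier_vec n\<close> are ever used.
\<close>

definition enorm :: "real vec \<Rightarrow> real" where
  "enorm v = sqrt (v \<bullet> v)"

definition edist :: "real vec \<Rightarrow> real vec \<Rightarrow> real" where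
  "edist v w = (if dim_vec v = dim_vec w then enorm (v - w) else 1)"
  \<comment> \<open>The value 1 is never used; it is there because \<^const>\<open>Metric_space\<close> asks for a distance that
    is symmetric and nonnegative on the whole type.\<close>

lemma enorm_conv_L2_set: "enorm v = L2_set (\<lambda>i. v $ i) {0..<dim_vec v}"
  by (simp add: enorm_def scalar_prod_def L2_set_def power2_eq_square)

lemma Metric_space_edist: "Metric_space (carrier_vec n) edist"
proof
  show "0 \<le> edist v w" for v w
    by (simp add: edist_def enorm_conv_L2_set)
  show "edist v w = edist w v" for v w
    by (auto simp: edist_def enorm_conv_L2_set L2_set_def power2_commute)
  show "edist v w = 0 \<longleftrightarrow> v = w" if "v \<in> carrier_vec n" "w \<in> carrier_vec n" for v w
    using that by (auto simp: edist_def enorm_conv_L2_set L2_set_eq_0_iff)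
  show "edist u w \<le> edist u v + edist v w"
    if "u \<in> carrier_vec n" "v \<in> carrier_vec n" "w \<in> carrier_vec n" for u v w
  proof -
    have "L2_set (\<lambda>i. (u $ i - v $ i) + (v $ i - w $ i)) {0..<n}
        \<le> L2_set (\<lambda>i. u $ i - v $ i) {0..<n} + L2_set (\<lambda>i. v $ i - w $ i) {0..<n}"
      by (rule L2_set_triangle_ineq)
    with that show ?thesis
      by (simp add: edist_def enorm_conv_L2_set L2_set_def)
  qed
qed

definition Rn_topology :: "nat \<Rightarrow> real vec topology" where
  "Rn_topology n = Metric_space.mtopology (carrier_vec n) edist"

text \<open>The unit sphere of \<open>\<real>\<^sup>n\<close>; the index is the dimension of the ambient space, so this is the
  paper's \<open>S\<^bsub>n-1\<^esub>\<close>.\<close>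

definition usphere :: "nat \<Rightarrow> real vec set" where
  "usphere n = {l \<in> carrier_vec n. enorm l = 1}"

definition rspan :: "nat \<Rightarrow> real vec set \<Rightarrow> real vec set" where
  "rspan n = LinearCombinations.module.span class_ring (module_vec TYPE(real) n)"

definition orth_compl :: "nat \<Rightarrow> real vec set \<Rightarrow> real vec set" where
  "orth_compl n W = {v \<in> carrier_vec n. \<forall>w\<in>W. v \<bullet> w = 0}"

definition rotation_mat :: "nat \<Rightarrow> real mat \<Rightarrow> bool" where
  "rotation_mat n Q \<longleftrightarrow>
     Q \<in> carrier_mat n n \<and> transpose_mat Q * Q = 1\<^sub>m n \<and> Determinant.det Q = 1"

definition rotation_family :: "(nat \<Rightarrow> real vec \<Rightarrow> real mat) \<Rightarrow> bool" where
  "rotation_family R \<longleftrightarrow>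
     (\<forall>n\<ge>2. \<forall>l\<in>usphere n.
        rotation_mat n (R n l) \<and>
        R n l *\<^sub>v l = unit_vec n (n - 1) \<and>
        (\<lambda>v. R n l *\<^sub>v v) ` orth_compl n (rspan n {l}) = rspan n {unit_vec n i | i. i < n - 1})"

definition proj_mat :: "nat \<Rightarrow> real mat" where
  "proj_mat n = mat (n - 1) n (\<lambda>(i, j). if i = j then 1 else 0)"

definition Pi_mat :: "(nat \<Rightarrow> real vec \<Rightarrow> real mat) \<Rightarrow> nat \<Rightarrow> real vec \<Rightarrow> real mat" where
  "Pi_mat R n l = proj_mat n * R n l"

definition has_dirderiv :: "(real vec \<Rightarrow> real) \<Rightarrow> real vec \<Rightarrow> real vec \<Rightarrow> real \<Rightarrow> bool" where
  "has_dirderiv f x l d \<longleftrightarrow> ((\<lambda>t. (f (x + t \<cdot>\<^sub>v l) - f x) / t) \<longlongrightarrow> d) (at_right 0)"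

definition dirderiv :: "(real vec \<Rightarrow> real) \<Rightarrow> real vec \<Rightarrow> real vec \<Rightarrow> real" where
  "dirderiv f x l = Lim (at_right 0) (\<lambda>t. (f (x + t \<cdot>\<^sub>v l) - f x) / t)"

text \<open>The function \<open>f\<^sub>l : \<real>\<^bsup>n-1\<^esup> \<Rightarrow> \<real>\<close>.\<close>

definition dirslice ::
  "(nat \<Rightarrow> real vec \<Rightarrow> real mat) \<Rightarrow> nat \<Rightarrow> (real vec \<Rightarrow> real) \<Rightarrow> real vec \<Rightarrow> real vec \<Rightarrow> real vec \<Rightarrow> real"
  where "dirslice R n f x l = (\<lambda>y. dirderiv f x (l + transpose_mat (Pi_mat R n l) *\<^sub>v y))"

text \<open>
  The carrier type of directed sets of all dimensions. \<open>Dir1 a b\<close> is the pair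
  \<open>(a\<^sub>1(-1), a\<^sub>1(1))\<close>; \<open>DirS B a\<close> is the family \<open>(B(l), a(l))\<close> for \<open>l\<close> in the unit sphere. Families
  indexed by the sphere are functions that are extensional on it.
\<close>

datatype dirset = Dir1 real real | DirS "real vec \<Rightarrow> dirset" "real vec \<Rightarrow> real"

fun dirset_norm :: "nat \<Rightarrow> dirset \<Rightarrow> real" where
  "dirset_norm (Suc 0) (Dir1 a b) = max \<bar>a\<bar> \<bar>b\<bar>"
| "dirset_norm (Suc (Suc n)) (DirS B a) =
     max (SUP l\<in>usphere (Suc (Suc n)). dirset_norm (Suc n) (B l))
         (SUP l\<in>usphere (Suc (Suc n)). \<bar>a l\<bar>)"
| "dirset_norm _ _ = undefined"

text \<open>The set \<open>\<D>(\<real>\<^sup>n)\<close>; dimension 0 does not occur.\<close>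

fun dirsets :: "nat \<Rightarrow> dirset set" where
  "dirsets 0 = {}"
| "dirsets (Suc 0) = {Dir1 a b | a b. True}"
| "dirsets (Suc (Suc n)) =
     {DirS B a | B a.
        B \<in> usphere (Suc (Suc n)) \<rightarrow>\<^sub>E dirsets (Suc n) \<and>
        (\<exists>K. \<forall>l\<in>usphere (Suc (Suc n)). dirset_norm (Suc n) (B l) \<le> K) \<and>
        a \<in> extensional (usphere (Suc (Suc n))) \<and>
        continuous_map (subtopology (Rn_topology (Suc (Suc n))) (usphere (Suc (Suc n))))
          euclideanreal a}"

text \<open>\<open>M\<close>-directed subdifferentiability at \<open>x\<close>. The derivative is required to exist, and to be
  continuous in the direction, on all of \<open>\<real>\<^sup>n\<close> and not only on the sphere, since \<^const>\<open>dirslice\<close>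
  evaluates it at directions that are not normalized.\<close>

fun M_dir_subdiff ::
  "(nat \<Rightarrow> real vec \<Rightarrow> real mat) \<Rightarrow> nat \<Rightarrow> real \<Rightarrow> (real vec \<Rightarrow> real) \<Rightarrow> real vec \<Rightarrow> bool" where
  "M_dir_subdiff R 0 M f x \<longleftrightarrow> False"
| "M_dir_subdiff R (Suc 0) M f x \<longleftrightarrow>
     (\<exists>d. has_dirderiv f x (- unit_vec 1 0) d) \<and> (\<exists>d. has_dirderiv f x (unit_vec 1 0) d) \<and>
     max \<bar>dirderiv f x (- unit_vec 1 0)\<bar> \<bar>dirderiv f x (unit_vec 1 0)\<bar> \<le> M"
| "M_dir_subdiff R (Suc (Suc n)) M f x \<longleftrightarrow>
     (\<forall>l\<in>carrier_vec (Suc (Suc n)). \<exists>d. has_dirderiv f x l d) \<and>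
     continuous_map (Rn_topology (Suc (Suc n))) euclideanreal (dirderiv f x) \<and>
     (\<forall>l\<in>usphere (Suc (Suc n)). \<bar>dirderiv f x l\<bar> \<le> M) \<and>
     (\<forall>l\<in>usphere (Suc (Suc n)).
        M_dir_subdiff R (Suc n) M (dirslice R (Suc (Suc n)) f x l) (0\<^sub>v (Suc n)))"

definition dir_subdiff ::
  "(nat \<Rightarrow> real vec \<Rightarrow> real mat) \<Rightarrow> nat \<Rightarrow> (real vec \<Rightarrow> real) \<Rightarrow> real vec \<Rightarrow> bool" where
  "dir_subdiff R n f x \<longleftrightarrow> (\<exists>M\<ge>0. M_dir_subdiff R n M f x)"

text \<open>The directed subdifferential.\<close>

fun dsub ::
  "(nat \<Rightarrow> real vec \<Rightarrow> real mat) \<Rightarrow> nat \<Rightarrow> (real vec \<Rightarrow> real) \<Rightarrow> real vec \<Rightarrow> dirset" where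
  "dsub R 0 f x = undefined"
| "dsub R (Suc 0) f x = Dir1 (dirderiv f x (- unit_vec 1 0)) (dirderiv f x (unit_vec 1 0))"
| "dsub R (Suc (Suc n)) f x =
     DirS (\<lambda>l\<in>usphere (Suc (Suc n)). dsub R (Suc n) (dirslice R (Suc (Suc n)) f x l) (0\<^sub>v (Suc n)))
          (\<lambda>l\<in>usphere (Suc (Suc n)). dirderiv f x l)"

end

theory Submission
  imports Defs
begin

text \<open>By induction on the dimension, once \<open>f\<close> is \<open>K\<close>-directed subdifferentiable for some \<open>K\<close>, it is
  \<open>M\<close>-directed subdifferentiable exactly for those \<open>M\<close> that are at least the norm of the directed
  subdifferential: \<open>K\<close> bounds all the suprema in the norm, so such a supremum is at most \<open>M\<close> iff all
  its members are. Hence the set of admissible \<open>M\<close> is a closed half-line.\<close>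

lemma usphere_nonempty: "usphere (Suc n) \<noteq> {}"
proof -
  have "unit_vec (Suc n) 0 \<in> usphere (Suc n)"
    by (simp add: usphere_def enorm_def)
  then show ?thesis by blast
qed

text \<open>\<open>M\<close> bounds the absolute value of some derivative; from dimension 2 on this
  uses that the sphere has a point.\<close>

lemma M_dir_subdiff_nonneg:
  assumes "M_dir_subdiff R n M f x"
  shows "0 \<le> M"
  using assms
proof (cases "(R, n, M, f, x)" rule: M_dir_subdiff.cases)
  case (3 R' m M' f' x')
  moreover obtain l where "l \<in> usphere (Suc (Suc m))"
    using usphere_nonempty by blast
  ultimately show ?thesis
    using assms by (auto intro: order_trans[OF abs_ge_zero])
qed (use assms in auto)

lemma dsub_dirset_and_M_dir_subdiff_iff:
  assumes "M_dir_subdiff R (Suc n) K f x"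
  shows "dsub R (Suc n) f x \<in> dirsets (Suc n) \<and>
    (\<forall>M. M_dir_subdiff R (Suc n) M f x \<longleftrightarrow> dirset_norm (Suc n) (dsub R (Suc n) f x) \<le> M)"
  using assms
\<comment> \<open>\<open>f\<close> and \<open>x\<close> vary because the induction hypothesis is
  applied to the slices \<open>?g l\<close> at the origin.\<close>
proof (induction n arbitrary: f x)
  case 0
  then show ?case by auto
next
  case (Suc n)
  let ?S = "usphere (Suc (Suc n))"
  let ?g = "\<lambda>l. dirslice R (Suc (Suc n)) f x l"
  let ?B = "\<lambda>l. dsub R (Suc n) (?g l) (0\<^sub>v (Suc n))"
  let ?N = "\<lambda>l. dirset_norm (Suc n) (?B l)"
  let ?a = "dirderiv f x"
  have ex: "\<forall>l\<in>carrier_vec (Suc (Suc n)). \<exists>d. has_dirderiv f x l d"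
    and cont: "continuous_map (Rn_topology (Suc (Suc n))) euclideanreal ?a"
    and a_le: "\<And>l. l \<in> ?S \<Longrightarrow> \<bar>?a l\<bar> \<le> K"
    and slice: "\<And>l. l \<in> ?S \<Longrightarrow> M_dir_subdiff R (Suc n) K (?g l) (0\<^sub>v (Suc n))"
    using Suc.prems by auto
  have B_mem: "?B l \<in> dirsets (Suc n)"
    and B_iff: "M_dir_subdiff R (Suc n) M (?g l) (0\<^sub>v (Suc n)) \<longleftrightarrow> ?N l \<le> M"
    if "l \<in> ?S" for l M
    using Suc.IH[OF slice[OF that]] by auto
  \<comment> \<open>\<open>B_iff\<close> at \<open>M = K\<close> makes the norms of the slices
    uniformly bounded, as membership in \<open>dirsets\<close> demands.\<close>
  have N_le: "?N l \<le> K" if "l \<in> ?S" for l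
    using B_iff slice that by blast
  have cont': "continuous_map (subtopology (Rn_topology (Suc (Suc n))) ?S) euclideanreal
      (restrict ?a ?S)"
    by (rule continuous_map_eq[OF continuous_map_from_subtopology[OF cont]]) auto
  have mem: "dsub R (Suc (Suc n)) f x \<in> dirsets (Suc (Suc n))"
    using B_mem N_le cont' by auto
  have "(SUP l\<in>?S. ?N l) \<le> M \<longleftrightarrow> (\<forall>l\<in>?S. ?N l \<le> M)"
    and "(SUP l\<in>?S. \<bar>?a l\<bar>) \<le> M \<longleftrightarrow> (\<forall>l\<in>?S. \<bar>?a l\<bar> \<le> M)" for M
    using N_le a_le by (auto intro!: cSUP_le_iff usphere_nonempty bdd_aboveI2)
  \<comment> \<open>Existence and continuity of the derivative do not involve \<open>M\<close>, so
    only the two bounds over the sphere remain to be compared; \<open>SUP_cong\<close> removes the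
    restrictions to the sphere made in \<open>dsub\<close>.\<close>
  then have "M_dir_subdiff R (Suc (Suc n)) M f x \<longleftrightarrow>
      dirset_norm (Suc (Suc n)) (dsub R (Suc (Suc n)) f x) \<le> M" for M
    using ex cont B_iff by (auto cong: SUP_cong)
  with mem show ?case by blast
qed

theorem lemma5p4:
  fixes R :: "nat \<Rightarrow> real vec \<Rightarrow> real mat"
    and n :: nat
    and f :: "real vec \<Rightarrow> real"
    and x :: "real vec"
  assumes "rotation_family R"
    and "n \<ge> 1"
    and "x \<in> carrier_vec n"
    and "dir_subdiff R n f x"
  shows "dsub R n f x \<in> dirsets n
    \<and> dirset_norm n (dsub R n f x) = Inf {M. M \<ge> 0 \<and> M_dir_subdiff R n M f x}
    \<and> Inf {M. M \<ge> 0 \<and> M_dir_subdiff R n M f x} \<in> {M. M \<ge> 0 \<and> M_dir_subdiff R n M f x}"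
proof -
  obtain m where n: "n = Suc m"
    using assms(2) by (cases n) auto
  obtain K where "M_dir_subdiff R (Suc m) K f x"
    using assms(4) by (auto simp: dir_subdiff_def n)
  from dsub_dirset_and_M_dir_subdiff_iff[OF this]
  have mem: "dsub R n f x \<in> dirsets n"
    and iff: "\<And>M. M_dir_subdiff R n M f x \<longleftrightarrow> dirset_norm n (dsub R n f x) \<le> M"
    by (auto simp: n)
  \<comment> \<open>Every \<open>M\<close> in the half-line is admissible by \<open>iff\<close>,
    hence nonnegative. The half-line contains its infimum, which gives both the equality and the
    attainment.\<close>
  have "{M. M \<ge> 0 \<and> M_dir_subdiff R n M f x} = {dirset_norm n (dsub R n f x)..}"
    using M_dir_subdiff_nonneg[of R n _ f x] iff by auto
  with mem show ?thesis by simp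
qed

end
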